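(* Let $P,Q\in\mathbb{R}^{d\times n}$ have columns $p^{(i)},q^{(i)}\in\mathbb{R}^d$, $i=1,\dots,n$, let $R_0\in O(d)$, $t_0\in\mathbb{R}^d$ and $I\subseteq\{1,\dots,n\}$, and suppose that $P,Q$ satisfy the affine dominance-of-inliers property (affine DIP) with respect to $(R_0,t_0,I)$. Then for any $p\in[1,\infty]$, the unique global minimizer of $\mathrm{E}_p(A,t,s)$ over $A\in\mathbb{R}^{d\times d}$, $t,s\in\mathbb{R}^d$ is $(R_0,t_0,-R_0^Tt_0)$.
   Context: $\|\cdot\|$ is the Euclidean norm, $O(d)$ the set of $d\times d$ real orthogonal matrices, $I^C=\{1,\dots,n\}\setminus I$. $P,Q$ satisfy the affine DIP with respect to $(R_0,t_0,I)$ if $q^{(i)}=R_0p^{(i)}+t_0$ for all $i\in I$, and for every $u\in\mathbb{R}^d$ and $\alpha\in\mathbb{R}$ with $\|u\|+|\alpha|>0$, $$\sum_{i\in I}|\langle u,p^{(i)}\rangle+\alpha|>\sum_{i\in I^C}|\langle u,p^{(i)}\rangle+\alpha|\quad\text{and}\quad \sum_{i\in I}|\langle u,q^{(i)}\rangle+\alpha|>\sum_{i\in I^C}|\langle u,q^{(i)}\rangle+\alpha|.$$ For $A\in\mathbb{R}^{d\times d}$, $t,s\in\mathbb{R}^d$ and $1\le p<\infty$, $$\mathrm{E}_p(A,t,s)=\sum_{i=1}^n\left(\frac{\|Ap^{(i)}-q^{(i)}+t\|^p+\|A^Tq^{(i)}-p^{(i)}+s\|^p}{2}\right)^{1/p},$$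 and $\mathrm{E}_\infty(A,t,s)=\sum_{i=1}^n\max\{\|Ap^{(i)}-q^{(i)}+t\|,\|A^Tq^{(i)}-p^{(i)}+s\|\}$. *)

theory Defs
  imports "HOL-Analysis.Analysis"
begin

text \<open>
  A matrix of type \<^typ>\<open>real ^ 'n ^ 'd\<close> has \<open>CARD('d)\<close> rows and \<open>CARD('n)\<close> columns; the points
  $p^{(i)}$ and $q^{(i)}$ are \<^term>\<open>column i P\<close> and \<^term>\<open>column i Q\<close>.
\<close>

definition affine_DIP ::
  "real ^ 'n ^ 'd \<Rightarrow> real ^ 'n ^ 'd \<Rightarrow> real ^ 'd ^ 'd \<Rightarrow> real ^ 'd \<Rightarrow> 'n set \<Rightarrow> bool"
where
  "affine_DIP P Q R\<^sub>0 t\<^sub>0 I \<longleftrightarrow>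
     (\<forall>i\<in>I. column i Q = R\<^sub>0 *v column i P + t\<^sub>0) \<and>
     (\<forall>(u :: real ^ 'd) (\<alpha> :: real). norm u + \<bar>\<alpha>\<bar> > 0 \<longrightarrow>
        (\<Sum>i\<in>I. \<bar>u \<bullet> column i P + \<alpha>\<bar>) > (\<Sum>i\<in>- I. \<bar>u \<bullet> column i P + \<alpha>\<bar>) \<and>
        (\<Sum>i\<in>I. \<bar>u \<bullet> column i Q + \<alpha>\<bar>) > (\<Sum>i\<in>- I. \<bar>u \<bullet> column i Q + \<alpha>\<bar>))"

text \<open>
  The exponent is an extended real; the value is meaningful for \<open>1 \<le> p\<close> only.
\<close>

definition energy ::
  "ereal \<Rightarrow> real ^ 'n ^ 'd \<Rightarrow> real ^ 'n ^ 'd \<Rightarrow>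
   real ^ 'd ^ 'd \<Rightarrow> real ^ 'd \<Rightarrow> real ^ 'd \<Rightarrow> real"
where
  "energy p P Q A t s =
     (if p = \<infinity>
      then \<Sum>i\<in>UNIV. max (norm (A *v column i P - column i Q + t))
                         (norm (transpose A *v column i Q - column i P + s))
      else \<Sum>i\<in>UNIV. ((norm (A *v column i P - column i Q + t) powr real_of_ereal p
                      + norm (transpose A *v column i Q - column i P + s) powr real_of_ereal p) / 2)
                     powr (1 / real_of_ereal p))"

end

theory Submission
  imports Defs
begin

text \<open>
  By the power mean inequality every \<open>E\<^sub>p\<close> is at least the mean of the two sums of residual norms,
  with equality at the claimed minimizer, where the two residuals of each point have the same norm.
  So it suffices to minimize each of the two sums separately. The inliers contribute nothing at the
  claimed minimizer, and by the triangle inequality a perturbation \<open>x \<mapsto> B x + b\<close> of the affine map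
  strictly increases the sum as soon as the inliers dominate in \<open>\<parallel>B x + b\<parallel>\<close>. The hypothesis gives
  this dominance for \<open>\<bar>\<langle>B x + b, \<theta>\<rangle>\<bar>\<close> for every \<open>\<theta>\<close>; integrating over \<open>\<theta>\<close> in the unit ball recovers
  the Euclidean norm, because the integral of \<open>\<bar>\<langle>v, \<theta>\<rangle>\<bar>\<close> is rotation invariant in \<open>v\<close>.
\<close>

section \<open>Averaging absolute projections over the unit ball\<close>

lemma absolutely_integrable_continuous_compact:
  fixes f :: "'a::euclidean_space \<Rightarrow> 'b::euclidean_space"
  assumes "compact S" "continuous_on S f"
  shows "f absolutely_integrable_on S"
  using borel_integrable_compact[OF assms] unfolding set_integrable_def
  by (subst integrable_completion) (auto dest: borel_measurable_integrable)

text \<open>An orthogonal map taking \<open>v\<close> to \<open>w\<close> preserves the ball and its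
  volume, so the integral depends on \<open>norm v\<close> alone; absolute homogeneity then makes it
  linear in \<open>norm v\<close>.\<close>

lemma integral_cball_abs_inner:
  obtains c where "\<And>v :: real^'m::{finite,wellorder}.
    integral (cball 0 1) (\<lambda>x. \<bar>v \<bullet> x\<bar>) = c * norm v"
proof -
  define N :: "real^'m::{finite,wellorder} \<Rightarrow> real" where
    "N v = integral (cball 0 1) (\<lambda>x. \<bar>v \<bullet> x\<bar>)" for v
  have inv: "N v = N w" if vw: "norm v = norm w" for v w
  proof -
    obtain f where f: "orthogonal_transformation f" "f v = w"
      using orthogonal_transformation_exists[OF vw] .
    have im: "f ` cball 0 1 = cball 0 1"
      using image_orthogonal_transformation_cball[OF f(1)]
      by (simp add: linear_0 f(1) orthogonal_transformation_linear)
    \<comment> \<open>The change of variables is available for vector-valued integrands only.\<close>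
    define g :: "real^'m::{finite,wellorder} \<Rightarrow> real^'m::{finite,wellorder} \<Rightarrow> real^1" where
      "g u x = (\<chi> k. \<bar>u \<bullet> x\<bar>)" for u x
    have abs_int: "g u absolutely_integrable_on cball 0 1" for u
      unfolding g_def
      by (intro absolutely_integrable_continuous_compact continuous_intros) auto
    have N_g: "N u = integral (cball 0 1) (g u) $ 1" for u
      using integral_component_eq_cart[OF set_lebesgue_integral_eq_integral(1)[OF abs_int], of u 1]
      by (simp add: N_def g_def)
    have "integral (f ` cball 0 1) (g w)
        = \<bar>det (matrix f)\<bar> *\<^sub>R integral (cball 0 1) (g w \<circ> f)"
      by (rule integral_change_of_variables_linear)
        (simp_all add: im abs_int f(1) orthogonal_transformation_linear)
    moreover have "g w \<circ> f = g v"
      using f unfolding orthogonal_transformation_def by (auto simp: fun_eq_iff g_def)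
    moreover have "\<bar>det (matrix f)\<bar> = 1"
      using f(1) by (simp add: orthogonal_transformation_det)
    ultimately show ?thesis
      by (simp add: N_g im)
  qed
  define e :: "real^'m::{finite,wellorder}" where "e = axis undefined 1"
  have "N v = N e * norm v" for v
  proof -
    have "N v = N (norm v *\<^sub>R e)" by (rule inv) (simp add: e_def)
    then show ?thesis by (simp add: N_def abs_mult mult.commute)
  qed
  then show ?thesis using that[of "N e"] unfolding N_def by blast
qed

text \<open>The difference of the two sums is continuous and nonnegative in \<open>x\<close>, and
  its integral over the ball is a constant times the difference of the norm sums. Strictness is
  asked at one point only, since some directions may annihilate all the vectors.\<close>

lemma sum_norm_less_wellorder:
  fixes v :: "'i \<Rightarrow> real^'m::{finite,wellorder}" and w :: "'j \<Rightarrow> real^'m::_"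
  assumes le: "\<And>x. (\<Sum>j\<in>J. \<bar>w j \<bullet> x\<bar>) \<le> (\<Sum>i\<in>I. \<bar>v i \<bullet> x\<bar>)"
    and less: "(\<Sum>j\<in>J. \<bar>w j \<bullet> y\<bar>) < (\<Sum>i\<in>I. \<bar>v i \<bullet> y\<bar>)"
  shows "(\<Sum>j\<in>J. norm (w j)) < (\<Sum>i\<in>I. norm (v i))"
proof -
  let ?B = "cball 0 1 :: (real^'m::_) set"
  obtain c where c: "\<And>v :: real^'m::_. integral ?B (\<lambda>x. \<bar>v \<bullet> x\<bar>) = c * norm v"
    using integral_cball_abs_inner[where 'm = 'm] by blast
  define F where "F x = (\<Sum>i\<in>I. \<bar>v i \<bullet> x\<bar>) - (\<Sum>j\<in>J. \<bar>w j \<bullet> x\<bar>)" for x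
  \<comment> \<open>A sum over an infinite set is 0, which cannot exceed a nonnegative sum.\<close>
  have fin: "finite I" using less by (cases "finite I") (auto simp: sum_nonneg leD)
  have int: "(\<lambda>x. \<bar>u \<bullet> x\<bar>) integrable_on ?B" for u
    by (intro set_lebesgue_integral_eq_integral absolutely_integrable_continuous_compact
        continuous_intros) auto
  have contF: "continuous_on S F" for S
    unfolding F_def by (intro continuous_intros)
  have eq: "integral ?B F = c * ((\<Sum>i\<in>I. norm (v i)) - (\<Sum>j\<in>J. norm (w j)))"
  proof (cases "finite J")
    case True
    then show ?thesis unfolding F_def
      using fin int by (simp add: integral_diff integrable_sum integral_sum c
          sum_distrib_left right_diff_distrib)
  next
    case False
    then show ?thesis unfolding F_def
      using fin int by (simp add: integral_sum c sum_distrib_left)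
  qed
  have Fint: "F integrable_on ?B"
    by (intro set_lebesgue_integral_eq_integral absolutely_integrable_continuous_compact contF) auto
  have F0: "F x \<ge> 0" for x using le[of x] by (simp add: F_def)
  have "integral ?B F \<ge> 0" using F0 by (intro integral_nonneg Fint) auto
  moreover have "integral ?B F \<noteq> 0"
  proof
    assume "integral ?B F = 0"
    then have h: "(F has_integral 0) (closure (ball 0 1))"
      using Fint by (simp add: has_integral_integral)
    \<comment> \<open>\<open>F\<close> is absolutely homogeneous, so its positive value at
      \<open>y\<close> can be moved to the unit sphere, where a zero integral would force
      \<open>F\<close> to vanish.\<close>
    define z where "z = y /\<^sub>R norm y"
    have "y \<noteq> 0" using less by auto
    then have "z \<in> closure (ball 0 1)" by (simp add: z_def)
    then have "F z = 0"
      by (intro has_integral_0_closure_imp_0[OF contF F0 _ _ _ _ h])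
        (simp_all add: emeasure_ball emeasure_cball unit_ball_vol_pos)
    moreover have "F z = F y / norm y"
      by (simp add: F_def z_def abs_mult diff_divide_distrib sum_divide_distrib divide_inverse
          sum_distrib_left algebra_simps)
    ultimately show False using less \<open>y \<noteq> 0\<close> by (simp add: F_def)
  qed
  ultimately have pos: "0 < c * ((\<Sum>i\<in>I. norm (v i)) - (\<Sum>j\<in>J. norm (w j)))"
    unfolding eq by linarith
  \<comment> \<open>The sign of \<open>c\<close> is read off at a unit vector, where the integrand
    is nonnegative.\<close>
  have "0 \<le> c * norm (axis undefined 1 :: real^'m::_)"
    unfolding c[symmetric] by (intro integral_nonneg int) auto
  then have "0 \<le> c" by simp
  with pos show ?thesis by (simp add: zero_less_mult_iff)
qed

text \<open>
  Linear change of variables in the library needs a well-ordered index type; the coordinates are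
  therefore embedded isometrically into those indexed by \<^typ>\<open>'d bit0\<close>, which is one.
\<close>
lemma sum_norm_less:
  fixes v :: "'i \<Rightarrow> real^'d" and w :: "'j \<Rightarrow> real^'d"
  assumes le: "\<And>x. (\<Sum>j\<in>J. \<bar>w j \<bullet> x\<bar>) \<le> (\<Sum>i\<in>I. \<bar>v i \<bullet> x\<bar>)"
    and less: "(\<Sum>j\<in>J. \<bar>w j \<bullet> y\<bar>) < (\<Sum>i\<in>I. \<bar>v i \<bullet> y\<bar>)"
  shows "(\<Sum>j\<in>J. norm (w j)) < (\<Sum>i\<in>I. norm (v i))"
proof -
  obtain \<iota> :: "'d \<Rightarrow> 'd bit0" where \<iota>: "inj \<iota>"
    using card_le_inj[of "UNIV :: 'd set" "UNIV :: 'd bit0 set"] by auto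
  define E :: "real^'d \<Rightarrow> real^('d bit0)" where "E u = (\<Sum>k\<in>UNIV. u $ k *\<^sub>R axis (\<iota> k) 1)" for u
  define R :: "real^('d bit0) \<Rightarrow> real^'d" where "R x = (\<chi> k. x $ \<iota> k)" for x
  \<comment> \<open>\<open>R\<close> is the adjoint of \<open>E\<close> and also its left inverse:
    the hypotheses transfer from \<open>R x\<close> to \<open>x\<close>, with \<open>E y\<close> as
    the strict witness, and \<open>E\<close> is isometric.\<close>
  have ER: "E u \<bullet> x = u \<bullet> R x" for u x
    unfolding E_def R_def inner_sum_left by (simp add: inner_axis' inner_vec_def[of u])
  have RE: "R (E u) = u" for u
    using \<iota> by (simp add: R_def E_def vec_eq_iff axis_def inj_eq if_distrib cong: if_cong)
  have nE: "norm (E u) = norm u" for u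
    by (simp add: norm_eq_sqrt_inner ER RE)
  have "(\<Sum>j\<in>J. norm (E (w j))) < (\<Sum>i\<in>I. norm (E (v i)))"
    by (rule sum_norm_less_wellorder[where y = "E y"]) (simp_all add: ER RE le less)
  then show ?thesis by (simp add: nE)
qed

section \<open>Perturbations of an affine map\<close>

text \<open>Projecting \<open>B *v z + b\<close> onto \<theta> gives the affine functional with
  \<open>u = transpose B *v \<theta>\<close> and \<open>\<alpha> = b \<bullet> \<theta>\<close>, to
  which \<open>dom\<close> applies unless both vanish; in that case both sums are 0.\<close>

lemma sum_norm_affine_less:
  fixes x :: "'i \<Rightarrow> real^'d" and B :: "real^'d^'d" and b :: "real^'d"
  assumes dom: "\<And>u \<alpha>. norm u + \<bar>\<alpha>\<bar> > 0 \<Longrightarrow>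
      (\<Sum>i\<in>J. \<bar>u \<bullet> x i + \<alpha>\<bar>) < (\<Sum>i\<in>I. \<bar>u \<bullet> x i + \<alpha>\<bar>)"
    and nz: "B \<noteq> 0 \<or> b \<noteq> 0"
  shows "(\<Sum>i\<in>J. norm (B *v x i + b)) < (\<Sum>i\<in>I. norm (B *v x i + b))"
proof -
  have inner: "(B *v z + b) \<bullet> \<theta> = (transpose B *v \<theta>) \<bullet> z + b \<bullet> \<theta>" for z \<theta>
    by (metis dot_lmul_matrix inner_add_left inner_commute transpose_matrix_vector)
  obtain y where y: "transpose B *v y \<noteq> 0 \<or> b \<bullet> y \<noteq> 0"
  proof (cases "b = 0")
    case True
    then have "transpose B \<noteq> 0" using nz by (auto simp: vec_eq_iff transpose_def)
    then show ?thesis using that by (metis matrix_vector_mult_0 matrix_eq)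
  next
    case False
    then show ?thesis using that[of b] by simp
  qed
  show ?thesis
  proof (rule sum_norm_less)
    show "(\<Sum>j\<in>J. \<bar>(B *v x j + b) \<bullet> y\<bar>) < (\<Sum>i\<in>I. \<bar>(B *v x i + b) \<bullet> y\<bar>)"
      unfolding inner using y by (intro dom) (auto simp: add_pos_nonneg add_nonneg_pos)
    show "(\<Sum>j\<in>J. \<bar>(B *v x j + b) \<bullet> \<theta>\<bar>) \<le> (\<Sum>i\<in>I. \<bar>(B *v x i + b) \<bullet> \<theta>\<bar>)" for \<theta>
    proof (cases "norm (transpose B *v \<theta>) + \<bar>b \<bullet> \<theta>\<bar> > 0")
      case True
      then show ?thesis unfolding inner by (intro less_imp_le dom)
    next
      case False
      then have "transpose B *v \<theta> = 0 \<and> b \<bullet> \<theta> = 0"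
        by (smt (verit) norm_ge_zero norm_eq_zero)
      then show ?thesis unfolding inner by simp
    qed
  qed
qed

text \<open>The displacement \<open>D i\<close> is the whole new residual of an inlier and lowers
  the residual of an outlier by at most \<open>norm (D i)\<close>, so the gain exceeds the loss.
  \<open>A\<^sub>0\<close> is arbitrary, which lets the lemma serve both directions of the
  fit.\<close>

lemma sum_residual_less:
  fixes x y :: "'n::finite \<Rightarrow> real^'d" and A A\<^sub>0 :: "real^'d^'d" and b b\<^sub>0 :: "real^'d"
  assumes dom: "\<And>u \<alpha>. norm u + \<bar>\<alpha>\<bar> > 0 \<Longrightarrow>
      (\<Sum>i\<in>- I. \<bar>u \<bullet> x i + \<alpha>\<bar>) < (\<Sum>i\<in>I. \<bar>u \<bullet> x i + \<alpha>\<bar>)"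
    and fit: "\<And>i. i \<in> I \<Longrightarrow> A\<^sub>0 *v x i - y i + b\<^sub>0 = 0"
    and ne: "(A, b) \<noteq> (A\<^sub>0, b\<^sub>0)"
  shows "(\<Sum>i\<in>UNIV. norm (A\<^sub>0 *v x i - y i + b\<^sub>0)) < (\<Sum>i\<in>UNIV. norm (A *v x i - y i + b))"
proof -
  define D where "D i = (A - A\<^sub>0) *v x i + (b - b\<^sub>0)" for i
  have split: "sum f UNIV = sum f I + sum f (- I)" for f :: "'n \<Rightarrow> real"
    using sum.union_disjoint[of I "- I" f] by simp
  have D: "A *v x i - y i + b = (A\<^sub>0 *v x i - y i + b\<^sub>0) + D i" for i
    by (simp add: D_def matrix_vector_mult_diff_rdistrib)
  have "(\<Sum>i\<in>- I. norm (D i)) < (\<Sum>i\<in>I. norm (D i))"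
    unfolding D_def using ne by (intro sum_norm_affine_less dom) auto
  moreover have "(\<Sum>i\<in>- I. norm (A\<^sub>0 *v x i - y i + b\<^sub>0) - norm (D i))
      \<le> (\<Sum>i\<in>- I. norm (A *v x i - y i + b))"
    unfolding D by (intro sum_mono norm_diff_ineq)
  moreover have "(\<Sum>i\<in>I. norm (A *v x i - y i + b)) = (\<Sum>i\<in>I. norm (D i))"
    unfolding D by (intro sum.cong refl) (simp add: fit)
  moreover have "(\<Sum>i\<in>I. norm (A\<^sub>0 *v x i - y i + b\<^sub>0)) = 0"
    by (simp add: fit)
  ultimately show ?thesis unfolding split sum_subtractf by linarith
qed

section \<open>Comparison of the energy with the mean of the residual norms\<close>

lemma arith_mean_le_power_mean:
  fixes a b p :: real
  assumes "0 \<le> a" "0 \<le> b" "1 \<le> p"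
  shows "(a + b) / 2 \<le> ((a powr p + b powr p) / 2) powr (1 / p)"
proof -
  \<comment> \<open>This settles the case of a vanishing argument; for two positive ones, convexity
    of the power is used at the midpoint.\<close>
  have half: "(z / 2) powr p \<le> z powr p / 2" if "0 \<le> z" for z
  proof -
    have "2 powr 1 \<le> (2::real) powr p" using assms by (intro powr_mono) auto
    then have "z powr p / 2 powr p \<le> z powr p / 2" by (intro divide_left_mono) auto
    then show ?thesis using that by (simp add: powr_divide)
  qed
  have "((a + b) / 2) powr p \<le> (a powr p + b powr p) / 2"
  proof (cases "a = 0 \<or> b = 0")
    case True
    then show ?thesis using half assms by auto
  next
    case False
    then show ?thesis
      using convex_onD[OF powr_convex[OF assms(3)], of "1/2" a b] assms
      by (simp add: add_divide_distrib)
  qed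
  then have "(((a + b) / 2) powr p) powr (1 / p) \<le> ((a powr p + b powr p) / 2) powr (1 / p)"
    using assms by (intro powr_mono2) auto
  then show ?thesis using assms by (simp add: powr_powr)
qed

lemma energy_ge:
  assumes "1 \<le> p"
  shows "(\<Sum>i\<in>UNIV. (norm (A *v column i P - column i Q + t)
          + norm (transpose A *v column i Q - column i P + s)) / 2) \<le> energy p P Q A t s"
proof (cases "p = \<infinity>")
  case True
  then show ?thesis by (auto simp: energy_def intro!: sum_mono)
next
  case False
  with assms have "1 \<le> real_of_ereal p" by (cases p) auto
  with False show ?thesis
    by (auto simp: energy_def intro!: sum_mono arith_mean_le_power_mean)
qed

lemma energy_eq:
  assumes "1 \<le> p"
    and "\<And>i. norm (transpose A *v column i Q - column i P + s)
      = norm (A *v column i P - column i Q + t)"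
  shows "energy p P Q A t s = (\<Sum>i\<in>UNIV. norm (A *v column i P - column i Q + t))"
proof (cases "p = \<infinity>")
  case True
  then show ?thesis unfolding energy_def assms(2) by simp
next
  case False
  with assms have "1 \<le> real_of_ereal p" by (cases p) auto
  with False show ?thesis unfolding energy_def assms(2) by (simp add: powr_powr)
qed

section \<open>Strict minimality of the claimed triple\<close>

theorem theorem3p4:
  fixes P Q :: "real ^ 'n ^ 'd"
    and R\<^sub>0 :: "real ^ 'd ^ 'd"
    and t\<^sub>0 :: "real ^ 'd"
    and I :: "'n set"
    and p :: ereal
  assumes "orthogonal_matrix R\<^sub>0"
    and "affine_DIP P Q R\<^sub>0 t\<^sub>0 I"
    and "1 \<le> p"
  shows "{x. is_arg_min (\<lambda>(A, t, s). energy p P Q A t s) (\<lambda>_. True) x}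
           = {(R\<^sub>0, t\<^sub>0, - (transpose R\<^sub>0 *v t\<^sub>0))}"
proof -
  define s\<^sub>0 where "s\<^sub>0 = - (transpose R\<^sub>0 *v t\<^sub>0)"
  define a where "a A t = (\<Sum>i\<in>UNIV. norm (A *v column i P - column i Q + t))" for A t
  define b where "b A s = (\<Sum>i\<in>UNIV. norm (transpose A *v column i Q - column i P + s))" for A s
  note dip = assms(2)[unfolded affine_DIP_def]
  \<comment> \<open>By orthogonality the backward residual is the forward one, rotated and negated;
    this is what singles out \<open>s\<^sub>0\<close>.\<close>
  have backward: "transpose R\<^sub>0 *v column i Q - column i P + s\<^sub>0
      = - (transpose R\<^sub>0 *v (R\<^sub>0 *v column i P - column i Q + t\<^sub>0))" for i
    using assms(1) by (simp add: s\<^sub>0_def matrix_vector_mult_diff_distrib matrix_vector_right_distrib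
        matrix_vector_mul_assoc orthogonal_matrix_def)
  have "orthogonal_transformation ((*v) (transpose R\<^sub>0))"
    using assms(1) by (simp add: orthogonal_transformation_matrix)
  then have norm_back: "norm (transpose R\<^sub>0 *v column i Q - column i P + s\<^sub>0)
      = norm (R\<^sub>0 *v column i P - column i Q + t\<^sub>0)" for i
    unfolding backward norm_minus_cancel by (rule orthogonal_transformation_norm)
  have fit: "R\<^sub>0 *v column i P - column i Q + t\<^sub>0 = 0" if "i \<in> I" for i
    using dip that by simp
  then have fit_backward: "transpose R\<^sub>0 *v column i Q - column i P + s\<^sub>0 = 0" if "i \<in> I" for i
    unfolding backward using that by simp
  have a_less: "a R\<^sub>0 t\<^sub>0 < a A t" if "(A, t) \<noteq> (R\<^sub>0, t\<^sub>0)" for A t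
    unfolding a_def using dip fit that by (intro sum_residual_less[where I = I]) auto
  have b_less: "b R\<^sub>0 s\<^sub>0 < b A s" if "(A, s) \<noteq> (R\<^sub>0, s\<^sub>0)" for A s
  proof -
    \<comment> \<open>The backward fit is a forward fit from \<open>Q\<close> to \<open>P\<close>
      with the transposed matrix, and transposition is injective.\<close>
    have "(transpose A, s) \<noteq> (transpose R\<^sub>0, s\<^sub>0)"
      using that by (metis Pair_inject transpose_transpose)
    then show ?thesis
      unfolding b_def using dip fit_backward by (intro sum_residual_less[where I = I]) blast+
  qed
  have less: "energy p P Q R\<^sub>0 t\<^sub>0 s\<^sub>0 < energy p P Q A t s"
    if "(A, t, s) \<noteq> (R\<^sub>0, t\<^sub>0, s\<^sub>0)" for A t s
  proof -
    have "energy p P Q R\<^sub>0 t\<^sub>0 s\<^sub>0 = a R\<^sub>0 t\<^sub>0" "b R\<^sub>0 s\<^sub>0 = a R\<^sub>0 t\<^sub>0"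
      unfolding a_def b_def norm_back by (simp_all only: energy_eq[OF assms(3) norm_back])
    moreover have "(a A t + b A s) / 2 \<le> energy p P Q A t s"
      using energy_ge[OF assms(3), of A P Q t s]
      by (simp add: a_def b_def sum.distrib flip: sum_divide_distrib)
    moreover have "a R\<^sub>0 t\<^sub>0 \<le> a A t" "b R\<^sub>0 s\<^sub>0 \<le> b A s"
      using a_less[of A t] b_less[of A s] by fastforce+
    \<comment> \<open>A different triple differs in \<open>(A, t)\<close> or in
      \<open>(A, s)\<close>, so at least one of the two sums grows strictly.\<close>
    moreover have "a R\<^sub>0 t\<^sub>0 < a A t \<or> b R\<^sub>0 s\<^sub>0 < b A s"
      using a_less[of A t] b_less[of A s] that by auto
    ultimately show ?thesis by auto
  qed
  show ?thesis
    unfolding is_arg_min_def s\<^sub>0_def[symmetric]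
    using less by (fastforce dest: less_asym)
qed

end
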